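(* Let $b\ge 2$ be an integer and let $k,r,y$ be nonnegative integers with $2y<r<k-1$. If $r$ is even, then $\nu(k,r,y)=\gamma(k,r,y)+1$ and $\mu(k,r,y)=V(k,r,y)$. If $k-2=r\equiv 3\pmod 4$ and $y\geq\frac{r+1}{4}$, then $\nu(k,r,y)=\gamma(k,r,(r-3)/4)+1$ and $\mu(k,r,y)=V(k,r,(r-3)/4)$. Otherwise, $\nu(k,r,y)=\gamma(k,r,\delta(r,y))+1$ and $\mu(k,r,y)=V(k,r,\delta(r,y))$, where $\delta(r,y)=\min\left\{\left\lceil\frac{r-1}{4}\right\rceil,y\right\}$.
   Context: Fix an integer $b\ge 2$. A base $b$ over-expansion of a positive integer $N$ is a word $d_kd_{k-1}\cdots d_0$ over $\{0,1,\ldots,b\}$ with $d_k\neq 0$ and $\sum_{i=0}^k d_ib^i=N$; the ordinary base $b$ expansion is the unique one using only digits $0,\dots,b-1$. For $n\ge 2$, $s_b(n)$ is the number of base $b$ over-expansions of $n-1$; $s_b(0)=0$, $s_b(1)=1$. For nonnegative integers $k,r,y$: $I(k,r,y)=\{n\in\mathbb N: b^k<n\le b^k+\sum_{i=0}^y b^{r-2i}\}$, $\mu(k,r,y)=\max\{s_b(n):n\in I(k,r,y)\}$, and $\nu(k,r,y)=\min\{n\in I(k,r,y): s_b(n)=\mu(k,r,y)\}$. For nonnegative integers $k,r,x$ with $2x<r<k-1$, $w(k,r,x)$ is the word $10^{k-r-1}(10)^x0(10)^{\lfloor r/2\rfloor-x}0$ if $r$ is odd and $10^{k-r-1}(10)^x0(10)^{\lfloor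 r/2\rfloor-x}$ if $r$ is even (exponents denote repetition), and $\gamma(k,r,x)$ is the positive integer whose ordinary base $b$ expansion is $w(k,r,x)$. For integers $k,r,x$, $V(k,r,x)=\frac15\big((k-r)(2L_{r+2}-L_{r-4x+1})+2L_{r+1}+L_{r-4x+2}\big)$, where $L_j$ are the Lucas numbers with $L_1=1$, $L_2=3$, $L_{j+2}=L_{j+1}+L_j$ for all integers $j$. *)

theory Defs
  imports Complex_Main
begin

text \<open>Words are digit lists with the most significant digit first, so the digit \<open>d\<^sub>i\<close> of weight
  \<open>b ^ i\<close> is \<open>rev ds ! i\<close>.\<close>

definition word_value :: "nat \<Rightarrow> nat list \<Rightarrow> nat" where
  "word_value b ds = (\<Sum>i<length ds. rev ds ! i * b ^ i)"

definition over_expansion :: "nat \<Rightarrow> nat \<Rightarrow> nat list \<Rightarrow> bool" where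
  "over_expansion b N ds \<longleftrightarrow>
     ds \<noteq> [] \<and> set ds \<subseteq> {0..b} \<and> hd ds \<noteq> 0 \<and> word_value b ds = N"

definition ordinary_expansion :: "nat \<Rightarrow> nat \<Rightarrow> nat list \<Rightarrow> bool" where
  "ordinary_expansion b N ds \<longleftrightarrow> over_expansion b N ds \<and> set ds \<subseteq> {0..<b}"

lemma finite_over_expansions:
  assumes "b \<ge> 2"
  shows "finite {ds. over_expansion b N ds}"
proof (rule finite_subset)
  show "{ds. over_expansion b N ds} \<subseteq> {ds. set ds \<subseteq> {0..b} \<and> length ds \<le> N}"
  proof clarify
    fix ds assume "over_expansion b N ds"
    then have ne: "ds \<noteq> []" and s: "set ds \<subseteq> {0..b}" and h: "hd ds \<noteq> 0"
      and v: "(\<Sum>i<length ds. rev ds ! i * b ^ i) = N"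
      by (auto simp: over_expansion_def word_value_def)
    let ?k = "length ds - 1"
    have k: "?k < length ds" using ne by simp
    have "rev ds ! ?k * b ^ ?k \<le> (\<Sum>i<length ds. rev ds ! i * b ^ i)"
      by (rule member_le_sum) (use k in auto)
    moreover have "rev ds ! ?k = hd ds" using ne by (simp add: rev_nth hd_conv_nth)
    ultimately have "1 * b ^ ?k \<le> N" using h v
      by (metis One_nat_def Suc_leI le_trans mult_le_mono1 neq0_conv)
    moreover have "?k < b ^ ?k"
      using less_exp[of ?k] power_mono[of 2 b ?k] assms by linarith
    ultimately show "set ds \<subseteq> {0..b} \<and> length ds \<le> N" using s by auto
  qed
  show "finite {ds. set ds \<subseteq> {0..b} \<and> length ds \<le> N}"
    by (rule finite_lists_length_le) simp
qed

definition s :: "nat \<Rightarrow> nat \<Rightarrow> nat" where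
  "s b n = (if n = 0 then 0 else if n = 1 then 1 else card {ds. over_expansion b (n - 1) ds})"

text \<open>The exponent \<open>r - 2 * i\<close> is truncated at \<open>0\<close>; this has no effect when \<open>2 * y \<le> r\<close>.\<close>

definition I :: "nat \<Rightarrow> nat \<Rightarrow> nat \<Rightarrow> nat \<Rightarrow> nat set" where
  "I b k r y = {n. b ^ k < n \<and> n \<le> b ^ k + (\<Sum>i=0..y. b ^ (r - 2 * i))}"

definition \<mu> :: "nat \<Rightarrow> nat \<Rightarrow> nat \<Rightarrow> nat \<Rightarrow> nat" where
  "\<mu> b k r y = Max (s b ` I b k r y)"

definition \<nu> :: "nat \<Rightarrow> nat \<Rightarrow> nat \<Rightarrow> nat \<Rightarrow> nat" where
  "\<nu> b k r y = Min {n \<in> I b k r y. s b n = \<mu> b k r y}"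

definition word_power :: "nat list \<Rightarrow> nat \<Rightarrow> nat list" where
  "word_power u m = concat (replicate m u)"

definition w :: "nat \<Rightarrow> nat \<Rightarrow> nat \<Rightarrow> nat list" where
  "w k r x =
     [1] @ word_power [0] (k - r - 1) @ word_power [1, 0] x @ [0] @ word_power [1, 0] (r div 2 - x)
     @ (if odd r then [0] else [])"

definition \<gamma> :: "nat \<Rightarrow> nat \<Rightarrow> nat \<Rightarrow> nat \<Rightarrow> nat" where
  "\<gamma> b k r x = (THE N. 0 < N \<and> ordinary_expansion b N (w k r x))"

text \<open>Lucas numbers with arbitrary integer index: the recurrence is run in both directions from
  the indices \<open>1\<close> and \<open>2\<close>.\<close>

function lucas :: "int \<Rightarrow> int" where
  "lucas j =
     (if j = 1 then 1 else if j = 2 then 3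
      else if j > 2 then lucas (j - 1) + lucas (j - 2)
      else lucas (j + 2) - lucas (j + 1))"
  by auto
termination by (relation "measure (\<lambda>j. nat \<bar>2 * j - 3\<bar>)") auto

declare lucas.simps [simp del]

lemma lucas_1: "lucas 1 = 1" and lucas_2: "lucas 2 = 3"
  by (simp_all add: lucas.simps)

lemma lucas_rec: "lucas (j + 2) = lucas (j + 1) + lucas j"
proof (cases "j \<ge> 1")
  case True
  then show ?thesis by (subst lucas.simps) (simp add: algebra_simps)
next
  case False
  then have "lucas j = lucas (j + 2) - lucas (j + 1)" by (subst lucas.simps) simp
  then show ?thesis by simp
qed

definition V :: "int \<Rightarrow> int \<Rightarrow> int \<Rightarrow> real" where
  "V k r x =
     1 / 5 * real_of_int ((k - r) * (2 * lucas (r + 2) - lucas (r - 4 * x + 1))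
                          + 2 * lucas (r + 1) + lucas (r - 4 * x + 2))"

definition \<delta> :: "nat \<Rightarrow> nat \<Rightarrow> nat" where
  "\<delta> r y = min (nat \<lceil>(real r - 1) / 4\<rceil>) y"

end

theory Submission
  imports Defs "HOL-Number_Theory.Fib"
begin

text \<open>Reading base \<open>b\<close> expansions from left to right, \<open>s b (N + 1)\<close> and \<open>s b N\<close> evolve by a
  Stern-like recursion. The numbers \<open>n \<in> I b k r y\<close> are exactly those for which \<open>n - 1\<close> has the
  expansion \<open>1 0\<^bsup>k-r-1\<^esup> (10)\<^sup>i 0 z\<close> with \<open>i \<le> y\<close> and \<open>z\<close> an arbitrary word of length \<open>r - 2 i\<close>.
  For fixed \<open>i\<close> the alternating word \<open>z = 1010\<dots>\<close> is the unique optimum, and it yields the value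
  \<open>V k r i\<close>. Finally \<open>V k r (i + 1) - V k r i = (k - r) F\<^sub>m - F\<^sub>m\<^sub>+\<^sub>1\<close> with \<open>m = r - 4 i - 1\<close>. For
  even \<open>r\<close> this is positive, and for odd \<open>r\<close> it is negative for \<open>m \<le> 0\<close> and positive for \<open>m > 0\<close>, except for a tie at
  \<open>m = 2\<close>, \<open>k - r = 2\<close>; this makes the smallest maximising \<open>i\<close> explicit.\<close>

section \<open>Words, over-expansions and their last digit\<close>

lemma word_value_Nil [simp]: "word_value b [] = 0"
  by (simp add: word_value_def)

lemma word_value_snoc: "word_value b (ds @ [d]) = b * word_value b ds + d"
  by (simp add: word_value_def sum.lessThan_Suc_shift sum_distrib_left algebra_simps
      del: sum.lessThan_Suc)

lemma word_value_append:
  "word_value b (xs @ ys) = word_value b xs * b ^ length ys + word_value b ys"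
  by (induction ys rule: rev_induct)
    (simp_all add: word_value_snoc algebra_simps flip: append_assoc)

lemma word_value_singleton [simp]: "word_value b [d] = d"
  by (simp add: word_value_def)

definition over_words :: "nat \<Rightarrow> nat \<Rightarrow> nat list set" where
  "over_words b N =
     {ds. set ds \<subseteq> {0..b} \<and> (ds \<noteq> [] \<longrightarrow> hd ds \<noteq> 0) \<and> word_value b ds = N}"

lemma over_words_pos: "0 < N \<Longrightarrow> over_words b N = {ds. over_expansion b N ds}"
  by (auto simp: over_words_def over_expansion_def)

lemma word_value_pos:
  assumes "b \<ge> 2" "ds \<noteq> []" "hd ds \<noteq> 0"
  shows "0 < word_value b ds"
proof -
  obtain d es where ds: "ds = d # es" using assms(2) by (cases ds) auto
  then show ?thesis
    using assms word_value_append[of b "[d]" es] by auto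
qed

lemma over_words_0: "b \<ge> 2 \<Longrightarrow> over_words b 0 = {[]}"
  using word_value_pos by (fastforce simp: over_words_def)

lemma finite_over_words: "b \<ge> 2 \<Longrightarrow> finite (over_words b N)"
  by (cases "N = 0") (simp_all add: over_words_0 over_words_pos finite_over_expansions)

lemma s_Suc_eq_card: "b \<ge> 2 \<Longrightarrow> s b (Suc N) = card (over_words b N)"
  by (cases "N = 0") (simp_all add: s_def over_words_0 over_words_pos)

lemma over_words_snoc:
  assumes "0 < N"
  shows "ds @ [d] \<in> over_words b N \<longleftrightarrow>
         d \<le> b \<and> (\<exists>m. N = b * m + d \<and> ds \<in> over_words b m)"
  using assms by (cases "ds = []") (auto simp: over_words_def word_value_snoc)

lemma Nil_notin_over_words: "0 < N \<Longrightarrow> [] \<notin> over_words b N"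
  by (simp add: over_words_def)

text \<open>The value fixes the last digit modulo \<open>b\<close>. A nonzero residue rules out the
  digit \<open>b\<close>, so only \<open>d\<close> can end the word.\<close>

lemma over_words_digit:
  assumes "0 < d" "d < b"
  shows "over_words b (b * m + d) = (\<lambda>ds. ds @ [d]) ` over_words b m"
proof -
  have uniq: "d' = d \<and> m' = m" if "d' \<le> b" "b * m + d = b * m' + d'" for d' m'
  proof (cases "d' = b")
    case True
    then have "(b * m + d) mod b = (b * m' + b) mod b" using that by simp
    then show ?thesis using assms by simp
  next
    case False
    then have "d' < b" using that(1) by simp
    then have "(b * m + d) mod b = d" "(b * m' + d') mod b = d'" using assms(2) by simp_all
    then have "d = d'" using that(2) by metis
    then show ?thesis using that assms by simp
  qed
  have "ds \<in> over_words b (b * m + d) \<longleftrightarrow> ds \<in> (\<lambda>ds. ds @ [d]) ` over_words b m" for ds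
    using assms uniq
    by (cases ds rule: rev_cases) (auto simp: Nil_notin_over_words over_words_snoc)
  then show ?thesis by blast
qed

text \<open>Residue 0 leaves two possible last digits, \<open>0\<close> and \<open>b\<close>; the
  digit \<open>b\<close> lowers the value of the remaining prefix by one.\<close>

lemma over_words_zero:
  assumes "b \<ge> 2"
  shows "over_words b (b * Suc m) =
         (\<lambda>ds. ds @ [0]) ` over_words b (Suc m) \<union> (\<lambda>ds. ds @ [b]) ` over_words b m"
proof -
  have uniq: "(d' = 0 \<and> m' = Suc m) \<or> (d' = b \<and> m' = m)"
    if "d' \<le> b" "b * Suc m = b * m' + d'" for d' m'
  proof (cases "d' = b")
    case True
    then have "b * Suc m = b * Suc m'" using that by simp
    then show ?thesis using assms True by (metis Suc_inject mult_cancel1 not_numeral_le_zero)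
  next
    case False
    then have "(b * Suc m) mod b = (b * m' + d') mod b" using that by presburger
    then have "d' = 0" using False that assms by simp
    then show ?thesis using that assms by (metis add_0_right mult_cancel1 not_numeral_le_zero)
  qed
  have "ds \<in> over_words b (b * Suc m) \<longleftrightarrow>
    ds \<in> (\<lambda>ds. ds @ [0]) ` over_words b (Suc m) \<union> (\<lambda>ds. ds @ [b]) ` over_words b m" for ds
  proof (cases ds rule: rev_cases)
    case Nil
    then show ?thesis using assms Nil_notin_over_words[of "b * Suc m" b] by auto
  next
    case (snoc es d)
    have "0 < b * Suc m" using assms by simp
    then have "ds \<in> over_words b (b * Suc m) \<longleftrightarrow>
        d \<le> b \<and> (\<exists>m'. b * Suc m = b * m' + d \<and> es \<in> over_words b m')"
      using over_words_snoc snoc by blast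
    also have "\<dots> \<longleftrightarrow> (d = 0 \<and> es \<in> over_words b (Suc m)) \<or> (d = b \<and> es \<in> over_words b m)"
      (is "?l \<longleftrightarrow> ?r")
    proof
      assume ?l
      then show ?r using uniq by blast
    next
      have "b * Suc m = b * m + b" by simp
      then show ?l if ?r using that by (metis add_0_right le0 order_refl)
    qed
    finally show ?thesis using snoc by auto
  qed
  then show ?thesis by blast
qed

section \<open>Stern-like recursion for \<open>s\<close>\<close>

lemma s_0 [simp]: "s b 0 = 0" and s_1 [simp]: "s b (Suc 0) = 1"
  by (simp_all add: s_def)

lemma s_mult_add_Suc:
  assumes "0 < d" "d < b"
  shows "s b (Suc (b * m + d)) = s b (Suc m)"
proof -
  have "b \<ge> 2" using assms by simp
  then show ?thesis
    by (simp add: s_Suc_eq_card over_words_digit[OF assms] card_image inj_on_def)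
qed

text \<open>The summands count the words ending in \<open>0\<close> and in \<open>b\<close>. For
  \<open>m = 0\<close> the second kind does not occur, in agreement with
  \<open>s b 0 = 0\<close>.\<close>

lemma s_Suc_mult:
  assumes "b \<ge> 2"
  shows "s b (Suc (b * m)) = s b (Suc m) + s b m"
proof (cases m)
  case (Suc m')
  have "card (over_words b (b * Suc m')) =
      card ((\<lambda>ds. ds @ [0]) ` over_words b (Suc m')) + card ((\<lambda>ds. ds @ [b]) ` over_words b m')"
    unfolding over_words_zero[OF assms]
    by (rule card_Un_disjoint) (use assms in \<open>auto simp: finite_over_words\<close>)
  then show ?thesis
    using Suc by (simp only: s_Suc_eq_card[OF assms]) (simp add: card_image inj_on_def)
qed simp

text \<open>For positive \<open>m\<close>, \<open>b * m - 1\<close> ends in the digit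
  \<open>b - 1\<close>, which is neither \<open>0\<close> nor \<open>b\<close>; deleting it leaves
  \<open>m - 1\<close>.\<close>

lemma s_mult:
  assumes "b \<ge> 2"
  shows "s b (b * m) = s b m"
proof (cases m)
  case (Suc m')
  then have "b * m = Suc (b * m' + (b - 1))" using assms by simp
  then show ?thesis using s_mult_add_Suc[of "b - 1" b m'] assms Suc by (simp add: add.commute)
qed simp

text \<open>Reading a base \<open>b\<close> expansion from left to right, the pair \<open>(s b (N + 1), s b N)\<close> evolves by
  \<open>(u, v) \<mapsto> (u + v, v)\<close>, \<open>(u, u + v)\<close> or \<open>(u, u)\<close> according to whether the next digit is
  \<open>0\<close>, \<open>1\<close> or larger.\<close>

lemma s_digit:
  assumes "b \<ge> 2" "d < b"
  shows "s b (Suc (b * N + d)) = (if d = 0 then s b (Suc N) + s b N else s b (Suc N))"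
    and "s b (b * N + d) =
         (if d = 0 then s b N else if d = 1 then s b (Suc N) + s b N else s b (Suc N))"
proof -
  show "s b (Suc (b * N + d)) = (if d = 0 then s b (Suc N) + s b N else s b (Suc N))"
    using assms by (simp add: s_Suc_mult s_mult_add_Suc)
  have "s b (b * N + d) = s b (Suc N)" if "d \<ge> 2"
    using s_mult_add_Suc[of "d - 1" b N] that assms by simp
  then show "s b (b * N + d) =
         (if d = 0 then s b N else if d = 1 then s b (Suc N) + s b N else s b (Suc N))"
    using assms by (auto simp: s_Suc_mult s_mult)
qed

section \<open>Fibonacci bounds for appended digits\<close>

text \<open>The leading digit of \<open>M\<close> turns \<open>(u, v)\<close> into a pair whose
  larger entry is at most \<open>u + v\<close> and whose smaller entry is at most
  \<open>max u v\<close>. Iterating this worst case produces the Fibonacci coefficients.\<close>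

lemma s_append_le:
  assumes "b \<ge> 2" "M < b ^ Suc n"
  shows "s b (Suc (b ^ Suc n * N + M)) \<le>
         fib (n + 2) * max (s b (Suc N)) (s b N) + fib (n + 1) * min (s b (Suc N)) (s b N)"
  using assms(2)
proof (induction n arbitrary: N M)
  case 0
  then show ?case using s_digit[OF assms(1), of M N] by (auto simp: max_def min_def)
next
  case (Suc n)
  define d M' where "d = M div b ^ Suc n" and "M' = M mod b ^ Suc n"
  have M: "M = d * b ^ Suc n + M'" unfolding d_def M'_def by (rule div_mult_mod_eq[symmetric])
  have M': "M' < b ^ Suc n" using assms by (simp add: M'_def)
  have d: "d < b" using Suc.prems by (simp add: d_def less_mult_imp_div_less mult.commute)
  have eq: "b ^ Suc (Suc n) * N + M = b ^ Suc n * (b * N + d) + M'"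
    by (simp add: M algebra_simps)
  define u v where "u = s b (Suc N)" and "v = s b N"
  define F G where "F = fib (n + 2)" and "G = fib (n + 1)"
  have "s b (Suc (b ^ Suc (Suc n) * N + M)) \<le>
      F * max (s b (Suc (b * N + d))) (s b (b * N + d)) +
      G * min (s b (Suc (b * N + d))) (s b (b * N + d))"
    unfolding eq F_def G_def by (rule Suc.IH[OF M'])
  also have "\<dots> \<le> F * (u + v) + G * max u v"
    unfolding s_digit[OF assms(1) d] u_def[symmetric] v_def[symmetric]
    by (auto intro!: add_mono mult_le_mono2)
  also have "\<dots> = (F + G) * max u v + F * min u v"
    by (auto simp: max_def min_def algebra_simps)
  finally show ?case by (simp add: F_def G_def u_def v_def numeral_2_eq_2)
qed

text \<open>The number with base \<open>b\<close> expansion \<open>1010\<dots>10\<close> or \<open>1010\<dots>100\<close> of length \<open>n\<close>.\<close>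

fun alternating :: "nat \<Rightarrow> nat \<Rightarrow> nat" where
  "alternating b 0 = 0"
| "alternating b (Suc 0) = 0"
| "alternating b (Suc (Suc n)) = b ^ Suc n + alternating b n"

lemma alternating_less: "b \<ge> 2 \<Longrightarrow> alternating b n < b ^ n"
proof (induction b n rule: alternating.induct)
  case (3 b n)
  have "alternating b (Suc (Suc n)) < b ^ Suc n + b ^ n" using 3 by simp
  also have "\<dots> \<le> b ^ Suc n + b ^ Suc n" using 3 by simp
  also have "\<dots> = 2 * b ^ Suc n" by simp
  also have "\<dots> \<le> b * b ^ Suc n" using 3 by (intro mult_le_mono1)
  finally show ?case by simp
qed auto

text \<open>Always replacing the smaller component by the sum is the unique optimal strategy.\<close>

lemma s_append_eq_iff:
  assumes "b \<ge> 2" "M < b ^ Suc n"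
    and "0 < s b N" "0 < s b (Suc N)" "s b (Suc N) \<noteq> s b N"
  shows "s b (Suc (b ^ Suc n * N + M)) =
         fib (n + 2) * max (s b (Suc N)) (s b N) + fib (n + 1) * min (s b (Suc N)) (s b N)
         \<longleftrightarrow> M = (if s b N < s b (Suc N) then alternating b (Suc n) else alternating b n)"
  using assms(2-)
proof (induction n arbitrary: N M)
  case 0
  then show ?case using s_digit[OF assms(1), of M N] by (auto simp: max_def min_def)
next
  case (Suc n)
  define d M' where "d = M div b ^ Suc n" and "M' = M mod b ^ Suc n"
  have M: "M = d * b ^ Suc n + M'" unfolding d_def M'_def by (rule div_mult_mod_eq[symmetric])
  have M': "M' < b ^ Suc n" using assms by (simp add: M'_def)
  have d: "d < b" using Suc.prems by (simp add: d_def less_mult_imp_div_less mult.commute)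
  have eq: "b ^ Suc (Suc n) * N + M = b ^ Suc n * (b * N + d) + M'"
    by (simp add: M algebra_simps)
  define u v where "u = s b (Suc N)" and "v = s b N"
  have uv: "0 < u" "0 < v" "u \<noteq> v" using Suc.prems by (simp_all add: u_def v_def)
  define F G where "F = fib (n + 2)" and "G = fib (n + 1)"
  have FG: "0 < F" "0 < G" by (simp_all add: F_def G_def fib_neq_0_nat)
  define X where "X = s b (Suc (b ^ Suc n * (b * N + d) + M'))"
  have bound: "fib (Suc n + 2) * max u v + fib (Suc n + 1) * min u v = F * (u + v) + G * max u v"
    by (simp add: F_def G_def numeral_2_eq_2 max_def min_def algebra_simps)
  have le: "X \<le> F * max (s b (Suc (b * N + d))) (s b (b * N + d)) +
      G * min (s b (Suc (b * N + d))) (s b (b * N + d))"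
    unfolding X_def F_def G_def by (rule s_append_le[OF assms(1) M'])
  \<comment> \<open>Digits from 2 on make both entries equal, so the induction hypothesis, which
    needs distinct entries, covers only the digits 0 and 1.\<close>
  have IH: "X = F * max (s b (Suc (b * N + d))) (s b (b * N + d)) +
      G * min (s b (Suc (b * N + d))) (s b (b * N + d)) \<longleftrightarrow>
      M' = (if s b (b * N + d) < s b (Suc (b * N + d)) then alternating b (Suc n) else alternating b n)"
    if "d \<le> 1"
    unfolding X_def F_def G_def
    by (rule Suc.IH[OF M']) (use that uv in \<open>auto simp: s_digit[OF assms(1) d] u_def v_def\<close>)
  have digit: "d = d' \<and> M' = A" if "M = d' * b ^ Suc n + A" "A < b ^ Suc n" for d' A
  proof -
    have "(d' * b ^ Suc n + A) div b ^ Suc n = d'" "(d' * b ^ Suc n + A) mod b ^ Suc n = A"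
      using that(2) assms(1) by (simp_all del: power_Suc)
    then show ?thesis unfolding d_def M'_def that(1) by blast
  qed
  have alt_less: "alternating b n < b ^ Suc n" "alternating b (Suc n) < b ^ Suc n"
    using alternating_less[OF assms(1), of "Suc n"] alternating_less[OF assms(1), of n] assms(1)
    by (auto intro: less_le_trans)
  have "X = F * (u + v) + G * max u v \<longleftrightarrow>
        M = (if v < u then alternating b (Suc (Suc n)) else alternating b (Suc n))"
  proof (cases "v < u")
    case True
    have "X = F * (u + v) + G * u \<longleftrightarrow> d = 1 \<and> M' = alternating b n"
    proof (cases "d = 1")
      case True
      then show ?thesis using IH uv s_digit[OF assms(1) d, of N, folded u_def v_def] \<open>v < u\<close>
        by (simp add: max_def min_def)
    next
      case False
      \<comment> \<open>Digit 0 does reach \<open>u + v\<close>, but keeps the smaller entry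
        \<open>v\<close> beside it instead of \<open>u\<close>; larger digits never form the
        sum.\<close>
      have "X < F * (u + v) + G * u"
      proof (cases "d = 0")
        case True
        then have "X \<le> F * (u + v) + G * v"
          using le s_digit[OF assms(1) d, of N, folded u_def v_def] uv
          by (simp add: max_def min_def)
        also have "\<dots> < F * (u + v) + G * u" using \<open>v < u\<close> FG by simp
        finally show ?thesis .
      next
        case False
        then have "X \<le> F * u + G * u"
          using le s_digit[OF assms(1) d, of N, folded u_def v_def] \<open>d \<noteq> 1\<close> by simp
        also have "\<dots> < F * (u + v) + G * u" using uv FG by simp
        finally show ?thesis .
      qed
      then show ?thesis using False by simp
    qed
    also have "\<dots> \<longleftrightarrow> M = alternating b (Suc (Suc n))"
      using digit[of 1 "alternating b n"] alt_less M by auto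
    finally show ?thesis using True by (simp add: max_def)
  next
    case False
    then have "u < v" using uv by simp
    have "X = F * (u + v) + G * v \<longleftrightarrow> d = 0 \<and> M' = alternating b (Suc n)"
    proof (cases "d = 0")
      case True
      then show ?thesis using IH uv s_digit[OF assms(1) d, of N, folded u_def v_def]
        by (simp add: max_def min_def)
    next
      case False
      have "X < F * (u + v) + G * v"
      proof (cases "d = 1")
        case True
        then have "X \<le> F * (u + v) + G * u"
          using le s_digit[OF assms(1) d, of N, folded u_def v_def] uv
          by (simp add: max_def min_def)
        also have "\<dots> < F * (u + v) + G * v" using \<open>u < v\<close> FG by simp
        finally show ?thesis .
      next
        case False
        then have "X \<le> F * u + G * u"
          using le s_digit[OF assms(1) d, of N, folded u_def v_def] \<open>d \<noteq> 0\<close> by simp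
        also have "\<dots> < F * (u + v) + G * v" using uv FG \<open>u < v\<close> 
          by (simp add: add_less_le_mono)
        finally show ?thesis .
      qed
      then show ?thesis using False by simp
    qed
    also have "\<dots> \<longleftrightarrow> M = alternating b (Suc n)"
      using digit[of 0 "alternating b (Suc n)"] alt_less M by auto
    finally show ?thesis using \<open>u < v\<close> by (simp add: max_def)
  qed
  then show ?case unfolding eq X_def[symmetric] u_def[symmetric] v_def[symmetric] bound .
qed

section \<open>Optimal continuation after a prefix \<open>(10)...(10)0\<close>\<close>

fun append_10 :: "nat \<Rightarrow> nat \<Rightarrow> nat \<Rightarrow> nat" where
  "append_10 b N 0 = N"
| "append_10 b N (Suc x) = append_10 b (b * (b * N + 1)) x"

text \<open>The largest value reached from the state \<open>(u, v)\<close> by the words \<open>(10)\<^sup>x 0 z\<close> with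
  \<open>z\<close> of length \<open>n\<close>.\<close>

fun peak :: "nat \<Rightarrow> nat \<Rightarrow> nat \<Rightarrow> nat \<Rightarrow> nat" where
  "peak n u v 0 = fib (Suc n) * (u + v) + fib n * v"
| "peak n u v (Suc x) = peak n (2 * u + v) (u + v) x"

text \<open>The digit 0 after the pairs \<open>10\<close> makes the first entry strictly larger. The
  entries are therefore distinct, and the unique optimal continuation starts with 1.\<close>

lemma s_le_peak:
  assumes "b \<ge> 2" "0 < n" "M < b ^ n" "0 < s b N" "0 < s b (Suc N)"
  shows "s b (Suc (b ^ n * (b * append_10 b N x) + M)) \<le> peak n (s b (Suc N)) (s b N) x"
    and "s b (Suc (b ^ n * (b * append_10 b N x) + M)) = peak n (s b (Suc N)) (s b N) x
         \<longleftrightarrow> M = alternating b n"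
proof -
  have "s b (Suc (b ^ n * (b * append_10 b N x) + M)) \<le> peak n (s b (Suc N)) (s b N) x \<and>
    (s b (Suc (b ^ n * (b * append_10 b N x) + M)) = peak n (s b (Suc N)) (s b N) x
         \<longleftrightarrow> M = alternating b n)"
    using assms(4,5)
  proof (induction x arbitrary: N)
    case 0
    obtain n' where n: "n = Suc n'" using assms(2) by (cases n) auto
    have st: "s b (Suc (b * N)) = s b (Suc N) + s b N" "s b (b * N) = s b N"
      using assms(1) by (simp_all add: s_Suc_mult s_mult)
    show ?case
      using s_append_le[of b M n' "b * N"] s_append_eq_iff[of b M n' "b * N"] assms(1,3) 0
      by (simp add: n st max_def min_def)
  next
    case (Suc x)
    let ?N = "b * (b * N + 1)"
    have "s b (Suc ?N) = 2 * s b (Suc N) + s b N" "s b ?N = s b (Suc N) + s b N"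
      using assms(1) s_digit[OF assms(1), of 1 N]
      by (simp_all only: s_Suc_mult s_mult) simp_all
    then show ?case using Suc.IH[of ?N] Suc.prems by simp
  qed
  then show "s b (Suc (b ^ n * (b * append_10 b N x) + M)) \<le> peak n (s b (Suc N)) (s b N) x"
    and "s b (Suc (b ^ n * (b * append_10 b N x) + M)) = peak n (s b (Suc N)) (s b N) x
         \<longleftrightarrow> M = alternating b n"
    by blast+
qed

section \<open>The leading block \<open>10...0\<close> and the values of the words\<close>

lemma s_power: "b \<ge> 2 \<Longrightarrow> s b (b ^ m) = 1"
  by (induction m) (simp_all add: s_mult)

lemma s_Suc_power: "b \<ge> 2 \<Longrightarrow> s b (Suc (b ^ m)) = Suc m"
proof (induction m)
  case 0
  then show ?case using s_mult_add_Suc[of 1 b 0] by simp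
qed (simp add: s_Suc_mult s_power)

text \<open>Both sides are the value of the expansion of \<open>N\<close> followed by
  \<open>x\<close> pairs \<open>10\<close>, one 0, and \<open>r - 2 * x\<close> further zeros. The
  ones of the pairs sit at the positions \<open>r\<close>, \<open>r - 2\<close>, and so on.\<close>

lemma append_10_value:
  assumes "2 * x \<le> r"
  shows "b ^ Suc r * N + (\<Sum>j<x. b ^ (r - 2 * j)) = b ^ (r - 2 * x) * (b * append_10 b N x)"
  using assms
proof (induction x arbitrary: r N)
  case (Suc x)
  define q where "q = r - 2"
  have r: "r = q + 2" using Suc.prems by (simp add: q_def)
  have "b ^ Suc r * N + (\<Sum>j<Suc x. b ^ (r - 2 * j)) =
        b ^ Suc q * (b * (b * N + 1)) + (\<Sum>j<x. b ^ (q - 2 * j))"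
    by (simp add: r sum.lessThan_Suc_shift algebra_simps del: sum.lessThan_Suc)
  also have "\<dots> = b ^ (q - 2 * x) * (b * append_10 b (b * (b * N + 1)) x)"
    by (rule Suc.IH) (use Suc.prems r in simp)
  finally show ?case by (simp add: r)
qed simp

lemma word_power_simps [simp]:
  "word_power u 0 = []" "word_power u (Suc m) = u @ word_power u m"
  by (simp_all add: word_power_def)

lemma word_power_Suc': "word_power u (Suc m) = word_power u m @ u"
  by (induction m) simp_all

lemma length_word_power [simp]: "length (word_power u m) = m * length u"
  by (induction m) simp_all

lemma word_value_replicate_0: "word_value b (word_power [0] m) = 0"
  by (induction m) (simp_all add: word_power_Suc' word_value_snoc del: word_power_simps(2))

lemma word_value_append_10:
  "word_value b (ds @ word_power [1, 0] x) = append_10 b (word_value b ds) x"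
proof (induction x arbitrary: ds)
  case (Suc x)
  have "word_value b (ds @ [1, 0]) = b * (b * word_value b ds + 1)"
    using word_value_snoc[of b "ds @ [1]" 0] by (simp add: word_value_snoc)
  then show ?case using Suc[of "ds @ [1, 0]"] by simp
qed simp

lemma length_alternating_word:
  "length (word_power [1, 0 :: nat] (n div 2) @ (if odd n then [0] else [])) = n"
  by auto presburger

lemma word_value_alternating:
  "word_value b (word_power [1, 0] (n div 2) @ (if odd n then [0] else [])) = alternating b n"
proof (induction b n rule: alternating.induct)
  case (3 b n)
  let ?t = "word_power [1, 0] (n div 2) @ (if odd n then [0] else [])"
  have "length ?t = n" by (rule length_alternating_word)
  then show ?case
    using 3 word_value_append[of b "[1, 0]" ?t] word_value_snoc[of b "[1]" 0] by simp
qed auto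

text \<open>All digits of \<open>w k r x\<close> are below \<open>b\<close>, so the definite
  description picks its value. The part after the isolated 0 is the alternating word of length
  \<open>r - 2 * x\<close>.\<close>

lemma gamma_eq:
  assumes "b \<ge> 2" "2 * x \<le> r" "r < k"
  shows "\<gamma> b k r x =
         b ^ (r - 2 * x) * (b * append_10 b (b ^ (k - r - 1)) x) + alternating b (r - 2 * x)"
    (is "_ = ?R")
proof -
  let ?p = "([1] @ word_power [0] (k - r - 1)) @ word_power [1, 0] x"
  let ?t = "word_power [1, 0] ((r - 2 * x) div 2) @ (if odd (r - 2 * x) then [0] else [])"
  have d: "r div 2 - x = (r - 2 * x) div 2" and o: "odd r \<longleftrightarrow> odd (r - 2 * x)"
    using assms(2) by presburger+
  have w: "w k r x = (?p @ [0]) @ ?t"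
    unfolding w_def d o by simp
  have len: "length ?t = r - 2 * x" by (rule length_alternating_word)
  have "word_value b ([1] @ word_power [0] (k - r - 1)) = b ^ (k - r - 1)"
    by (subst word_value_append) (simp add: word_value_replicate_0)
  then have "word_value b (?p @ [0]) = b * append_10 b (b ^ (k - r - 1)) x"
    by (simp only: word_value_snoc word_value_append_10)
  then have val: "word_value b (w k r x) = ?R"
    unfolding w word_value_append[of b "?p @ [0]"] len word_value_alternating
    by (simp add: mult.commute)
  have "set (word_power [1, 0] m) \<subseteq> {0..<b}" "set (word_power [0] m) \<subseteq> {0..<b}" for m
    by (induction m) (use assms(1) in auto)
  then have "set (w k r x) \<subseteq> {0..<b}"
    using assms(1) by (auto simp: w_def)
  then have ord: "ordinary_expansion b (word_value b (w k r x)) (w k r x)"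
    by (auto simp: ordinary_expansion_def over_expansion_def w_def)
  have "0 < word_value b (w k r x)"
    by (rule word_value_pos) (use assms(1) in \<open>simp_all add: w_def\<close>)
  with ord have "\<gamma> b k r x = word_value b (w k r x)"
    unfolding \<gamma>_def by (intro the_equality) (auto simp: ordinary_expansion_def over_expansion_def)
  then show ?thesis using val by simp
qed

section \<open>Reduction of \<open>\<mu>\<close> and \<open>\<nu>\<close> to a comparison of
  peaks\<close>

text \<open>This cuts \<open>I b k r y\<close> into consecutive blocks, the block \<open>i\<close>
  having length \<open>b ^ (r - 2 * i)\<close> and belonging to the prefix with \<open>i\<close>
  pairs \<open>10\<close>.\<close>

lemma less_sum_cases:
  fixes f :: "nat \<Rightarrow> nat"
  assumes "M < (\<Sum>j<m. f j)"
  shows "\<exists>i<m. \<exists>M'<f i. M = (\<Sum>j<i. f j) + M'"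
  using assms
proof (induction m)
  case (Suc m)
  show ?case
  proof (cases "M < (\<Sum>j<m. f j)")
    case True
    then show ?thesis using Suc.IH less_SucI by blast
  next
    case False
    then show ?thesis
      using Suc.prems by (intro exI[of _ m] exI[of _ "M - (\<Sum>j<m. f j)"] conjI) auto
  qed
qed simp

text \<open>Block \<open>i\<close> attains its maximum \<open>f i\<close> at exactly one point.
  Since the blocks are ordered from left to right, the smallest maximiser lies in the first block
  whose peak is greatest, and \<open>less\<close> makes this block \<open>x\<close>.\<close>

lemma mu_nu_eqI:
  fixes b k r y x :: nat
  defines "f \<equiv> \<lambda>i. peak (r - 2 * i) (k - r) 1 i"
  assumes b: "b \<ge> 2" and y: "2 * y < r" and r: "r < k - 1" and x: "x \<le> y"
    and le: "\<And>i. i \<le> y \<Longrightarrow> f i \<le> f x" and less: "\<And>i. i < x \<Longrightarrow> f i < f x"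
  shows "\<mu> b k r y = f x" and "\<nu> b k r y = \<gamma> b k r x + 1"
proof -
  define S where "S i = (\<Sum>j<i. b ^ (r - 2 * j))" for i
  define c where "c i = alternating b (r - 2 * i)" for i
  have c_less: "c i < b ^ (r - 2 * i)" for i
    unfolding c_def by (rule alternating_less[OF b])
  have S_Suc: "S (Suc i) = S i + b ^ (r - 2 * i)" for i by (simp add: S_def)
  have S_mono: "S i \<le> S j" if "i \<le> j" for i j
    unfolding S_def by (rule sum_mono2) (use that in auto)
  have pos: "b ^ k + S i = b ^ (r - 2 * i) * (b * append_10 b (b ^ (k - r - 1)) i)"
    if "i \<le> y" for i
  proof -
    have "b ^ Suc r * b ^ (k - r - 1) = b ^ k"
      using r by (simp flip: power_add power_Suc)
    then show ?thesis using append_10_value[of i r b "b ^ (k - r - 1)"] that y by (simp add: S_def)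
  qed
  have bound: "s b (Suc (b ^ k + S i + M)) \<le> f i"
      "s b (Suc (b ^ k + S i + M)) = f i \<longleftrightarrow> M = c i"
    if "i \<le> y" "M < b ^ (r - 2 * i)" for i M
  proof -
    \<comment> \<open>The leading block \<open>10...0\<close> leads to the state
      \<open>(k - r, 1)\<close>, which explains the arguments of \<open>peak\<close> in
      \<open>f\<close>.\<close>
    have "s b (Suc (b ^ (k - r - 1))) = k - r" "s b (b ^ (k - r - 1)) = 1"
      using b r by (simp_all add: s_Suc_power s_power)
    then show "s b (Suc (b ^ k + S i + M)) \<le> f i"
      "s b (Suc (b ^ k + S i + M)) = f i \<longleftrightarrow> M = c i"
      using s_le_peak[of b "r - 2 * i" M "b ^ (k - r - 1)" i] that y r b
      unfolding pos[OF that(1)] f_def c_def by simp_all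
  qed
  have gamma: "\<gamma> b k r x = b ^ k + S x + c x"
    using gamma_eq[of b x r k] pos[OF x] b x y r by (simp add: c_def)
  have I: "I b k r y = {n. b ^ k < n \<and> n \<le> b ^ k + S (Suc y)}"
    by (simp add: I_def S_def atLeast0AtMost lessThan_Suc_atMost)
  have fin: "finite (I b k r y)" by (simp add: I)
  have split: "\<exists>i M. i \<le> y \<and> M < b ^ (r - 2 * i) \<and> n = Suc (b ^ k + S i + M)"
    if "n \<in> I b k r y" for n
  proof -
    \<comment> \<open>The interval starts at \<open>b ^ k + 1\<close>, so this offset starts at
      0.\<close>
    have "n - Suc (b ^ k) < (\<Sum>j<Suc y. b ^ (r - 2 * j))"
      using that unfolding I S_def by (simp del: sum.lessThan_Suc) linarith
    then obtain i M where "i < Suc y" "M < b ^ (r - 2 * i)" "n - Suc (b ^ k) = S i + M"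
      using less_sum_cases unfolding S_def by blast
    moreover have "Suc (b ^ k) \<le> n" using that by (simp add: I)
    ultimately show ?thesis by (intro exI[of _ i] exI[of _ M]) auto
  qed
  have mem: "\<gamma> b k r x + 1 \<in> I b k r y"
    using S_Suc[of x] S_mono[of "Suc x" "Suc y"] c_less[of x] x by (simp add: I gamma)
  have val: "s b (\<gamma> b k r x + 1) = f x"
    using bound(2)[OF x c_less] by (simp add: gamma)
  show mu: "\<mu> b k r y = f x"
    unfolding \<mu>_def
  proof (rule Max_eqI)
    show "m \<le> f x" if "m \<in> s b ` I b k r y" for m
      using that split bound(1) le by (fastforce intro: order_trans)
    show "f x \<in> s b ` I b k r y" using mem val by (metis imageI)
  qed (use fin in simp)
  show "\<nu> b k r y = \<gamma> b k r x + 1"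
    unfolding \<nu>_def mu
  proof (rule Min_eqI)
    fix n assume n: "n \<in> {n \<in> I b k r y. s b n = f x}"
    then obtain i M where i: "i \<le> y" and M: "M < b ^ (r - 2 * i)"
      and eq: "n = Suc (b ^ k + S i + M)" using split by blast
    have "f x \<le> f i" using bound(1)[OF i M] n eq by simp
    then have "x \<le> i" using less[of i] by linarith
    show "\<gamma> b k r x + 1 \<le> n"
    proof (cases "i = x")
      case True
      then have "M = c i" using bound(2)[OF i M] n eq by simp
      then show ?thesis using True eq gamma by simp
    next
      case False
      \<comment> \<open>A later block begins only after block \<open>x\<close> has ended, hence to
        the right of its optimum.\<close>
      then have "S (Suc x) \<le> S i" using \<open>x \<le> i\<close> by (intro S_mono) simp
      then show ?thesis using S_Suc[of x] c_less[of x] by (simp add: eq gamma)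
    qed
  qed (use fin mem val in auto)
qed

section \<open>Lucas and Fibonacci numbers at integer indices\<close>

text \<open>Five times the Fibonacci number with integer index \<open>m\<close>.\<close>

definition lucas5 :: "int \<Rightarrow> int" where
  "lucas5 m = lucas (m + 1) + lucas (m - 1)"

lemma lucas5_rec: "lucas5 (m + 2) = lucas5 (m + 1) + lucas5 m"
  using lucas_rec[of "m + 1"] lucas_rec[of "m - 1"] by (simp add: lucas5_def algebra_simps)

lemma lucas_values: "lucas 0 = 2" "lucas (-1) = -1"
  using lucas_rec[of 0] lucas_rec[of "-1"] by (simp_all add: lucas_1 lucas_2)

lemma lucas5_of_nat: "lucas5 (int n) = 5 * int (fib n)"
proof (induction n rule: fib.induct)
  case (3 n)
  then show ?case using lucas5_rec[of "int n"] by (simp add: algebra_simps)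
qed (simp_all add: lucas5_def lucas_values lucas_1 lucas_2)

text \<open>The Fibonacci recurrence, run backwards from 0, alternates in sign; negative odd indices
  therefore give positive values.\<close>

lemma lucas5_neg_of_nat: "lucas5 (- int n) = (if even n then -5 else 5) * int (fib n)"
proof (induction n rule: fib.induct)
  case (3 n)
  have "lucas5 (- int n) = lucas5 (- int (Suc n)) + lucas5 (- int (Suc (Suc n)))"
    using lucas5_rec[of "- int (Suc (Suc n))"] by (simp add: algebra_simps)
  then show ?case using 3 by (simp split: if_splits)
next
  case 2
  show ?case using lucas5_rec[of "-1"] lucas5_of_nat[of 0] lucas5_of_nat[of 1] by simp
qed (simp add: lucas5_def lucas_values lucas_1)

lemma lucas5_odd_pos:
  assumes "odd m"
  shows "0 < lucas5 m"
proof (cases m rule: int_cases2)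
  case (nonneg n)
  then show ?thesis using assms by (auto simp: lucas5_of_nat fib_neq_0_nat elim: oddE)
next
  case (nonpos n)
  then show ?thesis using assms by (auto simp: lucas5_neg_of_nat fib_neq_0_nat elim: oddE)
qed

lemma lucas5_pos: "0 < m \<Longrightarrow> 0 < lucas5 m"
  using lucas5_of_nat[of "nat m"] fib_neq_0_nat[of "nat m"] by simp

lemma lucas5_nonpos: "even m \<Longrightarrow> m \<le> 0 \<Longrightarrow> lucas5 m \<le> 0"
  using lucas5_neg_of_nat[of "nat (- m)"] by (simp add: even_nat_iff)

text \<open>A pair \<open>10\<close> maps \<open>(u, v)\<close> to
  \<open>(2 * u + v, u + v)\<close>, so \<open>u\<close> and \<open>v\<close> vary in the induction.
  Comparing their coefficients leaves only Lucas recurrences. With \<open>n = r - 2 * x\<close> the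
  right-hand side takes the form of \<open>V\<close>.\<close>

lemma peak_lucas:
  "5 * int (peak n u v x) =
     int u * (2 * lucas (int n + 2 * int x + 2) - lucas (int n - 2 * int x + 1)) +
     int v * (2 * lucas (int n + 2 * int x + 1) + lucas (int n - 2 * int x + 2))"
proof (induction x arbitrary: u v)
  case 0
  have "5 * int (fib (Suc n)) = lucas (int n + 2) + lucas (int n)"
    "5 * int (fib n) = lucas (int n + 1) + lucas (int n - 1)"
    using lucas5_of_nat[of n] lucas5_of_nat[of "Suc n"] by (simp_all add: lucas5_def algebra_simps)
  moreover have "lucas (int n + 1) = lucas (int n) + lucas (int n - 1)"
    "lucas (int n + 2) = lucas (int n + 1) + lucas (int n)"
    using lucas_rec[of "int n - 1"] lucas_rec[of "int n"] by (simp_all add: add.commute)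
  ultimately show ?case by (simp add: algebra_simps flip: distrib_left) algebra
next
  case (Suc x)
  define p q where "p = int n + 2 * int x" and "q = int n - 2 * int x"
  have "lucas (p + 4) = lucas (p + 3) + lucas (p + 2)" "lucas (p + 3) = lucas (p + 2) + lucas (p + 1)"
    "lucas (q + 2) = lucas (q + 1) + lucas q" "lucas (q + 1) = lucas q + lucas (q - 1)"
    using lucas_rec[of "p + 2"] lucas_rec[of "p + 1"] lucas_rec[of q] lucas_rec[of "q - 1"]
    by (simp_all add: add.commute)
  moreover have idx: "int n + 2 * int (Suc x) + 2 = p + 4" "int n + 2 * int (Suc x) + 1 = p + 3"
    "int n - 2 * int (Suc x) + 1 = q - 1" "int n - 2 * int (Suc x) + 2 = q"
    by (simp_all add: p_def q_def)
  ultimately show ?case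
    unfolding idx peak.simps Suc.IH p_def[symmetric] q_def[symmetric]
    by (simp add: algebra_simps)
qed

lemma V_eq_peak:
  assumes "2 * x \<le> r" "r \<le> k"
  shows "V (int k) (int r) (int x) = real (peak (r - 2 * x) (k - r) 1 x)"
proof -
  have "5 * int (peak (r - 2 * x) (k - r) 1 x) =
    (int k - int r) * (2 * lucas (int r + 2) - lucas (int r - 4 * int x + 1)) +
     2 * lucas (int r + 1) + lucas (int r - 4 * int x + 2)"
    using peak_lucas[of "r - 2 * x" "k - r" 1 x] assms by (simp add: of_nat_diff algebra_simps)
  from this[symmetric] show ?thesis unfolding V_def by simp
qed

section \<open>Comparison of consecutive peaks\<close>

text \<open>The terms with index near \<open>r\<close> do not depend on \<open>i\<close> and cancel.
  The others combine by the identity that the Lucas numbers at \<open>m + 2\<close> and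
  \<open>m - 2\<close> differ by \<open>lucas5 m\<close>.\<close>

lemma peak_Suc_diff:
  fixes r a i :: nat
  assumes "2 * Suc i \<le> r"
  defines "m \<equiv> int r - 4 * int i - 1"
  shows "5 * (int (peak (r - 2 * Suc i) a 1 (Suc i)) - int (peak (r - 2 * i) a 1 i)) =
         int a * lucas5 m - lucas5 (m + 1)"
proof -
  have "lucas (m + 3) = lucas (m + 2) + lucas (m + 1)" "lucas (m + 2) = lucas (m + 1) + lucas m"
    "lucas (m + 1) = lucas m + lucas (m - 1)" "lucas m = lucas (m - 1) + lucas (m - 2)"
    using lucas_rec[of "m + 1"] lucas_rec[of m] lucas_rec[of "m - 1"] lucas_rec[of "m - 2"]
    by (simp_all add: add.commute)
  then have five: "lucas (m + 2) - lucas (m - 2) = lucas5 m"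
    "lucas (m + 3) - lucas (m - 1) = lucas5 (m + 1)"
    by (simp_all add: lucas5_def add.commute)
  have idx: "int (r - 2 * i) + 2 * int i = int r" "int (r - 2 * i) - 2 * int i = m + 1"
    "int (r - 2 * Suc i) + 2 * int (Suc i) = int r" "int (r - 2 * Suc i) - 2 * int (Suc i) = m - 3"
    using assms by simp_all
  have "5 * int (peak (r - 2 * i) a 1 i) =
      int a * (2 * lucas (int r + 2) - lucas (m + 2)) + (2 * lucas (int r + 1) + lucas (m + 3))"
    unfolding peak_lucas idx by (simp add: add.commute)
  moreover have "5 * int (peak (r - 2 * Suc i) a 1 (Suc i)) =
      int a * (2 * lucas (int r + 2) - lucas (m - 2)) + (2 * lucas (int r + 1) + lucas (m - 1))"
    unfolding peak_lucas idx by (simp add: add.commute)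
  ultimately show ?thesis
    unfolding right_diff_distrib five[symmetric] by (simp only:)
qed

text \<open>By the recurrence \<open>lucas5 (m + 1) = 2 * lucas5 m - lucas5 (m - 2)\<close>, which
  is below \<open>a * lucas5 m\<close> once \<open>lucas5 m\<close> and
  \<open>lucas5 (m - 2)\<close> are positive. This holds for odd \<open>m\<close> and for
  \<open>m \<ge> 4\<close>.\<close>

lemma peak_less_Suc:
  assumes "2 * Suc i \<le> r" "2 \<le> a"
    and "even r \<or> 4 * i + 3 \<le> r \<and> \<not> (r = 4 * i + 3 \<and> a = 2)"
  shows "peak (r - 2 * i) a 1 i < peak (r - 2 * Suc i) a 1 (Suc i)"
proof -
  define m where "m = int r - 4 * int i - 1"
  have rec: "lucas5 (m + 1) = lucas5 m + lucas5 (m - 1)" "lucas5 m = lucas5 (m - 1) + lucas5 (m - 2)"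
    using lucas5_rec[of "m - 1"] lucas5_rec[of "m - 2"] by (simp_all add: add.commute)
  have m: "odd m \<or> m \<ge> 4 \<or> m = 2 \<and> 3 \<le> a"
  proof -
    have "even r \<Longrightarrow> odd m" by (simp add: m_def)
    moreover have "odd r \<Longrightarrow> even m" by (simp add: m_def)
    moreover have "m \<ge> 2" "m \<noteq> 2 \<or> 3 \<le> a" if "odd r" using that assms by (auto simp: m_def)
    moreover have "m \<ge> 4" if "even m" "m \<ge> 2" "m \<noteq> 2" using that by presburger
    ultimately show ?thesis by blast
  qed
  have "lucas5 (m + 1) < int a * lucas5 m"
  \<comment> \<open>Here \<open>lucas5 (m - 2)\<close> vanishes and the estimate is no longer
    strict; \<open>a \<ge> 3\<close> is what breaks the tie.\<close>
  proof (cases "m = 2")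
    case True
    then have "3 \<le> a" using m by auto
    moreover have "lucas5 2 = 5" "lucas5 3 = 10"
      using lucas5_of_nat[of 2] lucas5_of_nat[of 3] by (simp_all add: numeral_eq_Suc)
    ultimately show ?thesis using True by simp
  next
    case False
    then have "0 < lucas5 m" "0 < lucas5 (m - 2)"
      using m lucas5_pos[of m] lucas5_pos[of "m - 2"] lucas5_odd_pos[of m] lucas5_odd_pos[of "m - 2"]
      by auto
    then have "lucas5 (m + 1) < 2 * lucas5 m" using rec by linarith
    also have "\<dots> \<le> int a * lucas5 m" using assms \<open>0 < lucas5 m\<close> by (intro mult_right_mono) auto
    finally show ?thesis .
  qed
  then show ?thesis using peak_Suc_diff[OF assms(1), of a] by (simp add: m_def)
qed

text \<open>If \<open>r \<le> 4 * i + 1\<close>, then \<open>m\<close> is even and nonpositive, so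
  \<open>lucas5 m \<le> 0 < lucas5 (m + 1)\<close>. The other alternative is the tie at
  \<open>m = 2\<close>.\<close>

lemma peak_Suc_le:
  assumes "2 * Suc i \<le> r" "odd r" and "r \<le> 4 * i + 1 \<or> r = 4 * i + 3 \<and> a = 2"
  shows "peak (r - 2 * Suc i) a 1 (Suc i) \<le> peak (r - 2 * i) a 1 i"
proof -
  define m where "m = int r - 4 * int i - 1"
  have "int a * lucas5 m \<le> lucas5 (m + 1)"
  proof (cases "r \<le> 4 * i + 1")
    case True
    then have "even m" "m \<le> 0" using assms(2) by (simp_all add: m_def)
    then have "lucas5 m \<le> 0" "0 < lucas5 (m + 1)"
      by (simp_all add: lucas5_nonpos lucas5_odd_pos)
    moreover from this have "int a * lucas5 m \<le> 0" by (simp add: mult_nonneg_nonpos)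
    ultimately show ?thesis by linarith
  next
    case False
    then have "m = 2" "a = 2" using assms by (auto simp: m_def)
    moreover have "lucas5 2 = 5" "lucas5 3 = 10"
      using lucas5_of_nat[of 2] lucas5_of_nat[of 3] by (simp_all add: numeral_eq_Suc)
    ultimately show ?thesis by simp
  qed
  then show ?thesis using peak_Suc_diff[OF assms(1), of a] by (simp add: m_def)
qed

section \<open>Location of the first greatest peak\<close>

text \<open>The ascent is strict and the descent weak, so \<open>x\<close> is the smallest maximiser
  even when later values tie with it.\<close>

lemma unimodal_max:
  fixes f :: "nat \<Rightarrow> nat"
  assumes inc: "\<And>i. i < x \<Longrightarrow> f i < f (Suc i)"
    and dec: "\<And>i. x \<le> i \<Longrightarrow> i < y \<Longrightarrow> f (Suc i) \<le> f i"
  shows "i < x \<Longrightarrow> f i < f x" and "i \<le> y \<Longrightarrow> f i \<le> f x"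
proof -
  show less: "f i < f x" if "i < x" for i
    using that inc by (induction rule: strict_inc_induct) (auto intro: less_trans)
  have ge: "i \<le> y \<longrightarrow> f i \<le> f x" if "x \<le> i" for i
    using that by (induction rule: dec_induct) (use dec order_trans in fastforce)+
  show "f i \<le> f x" if "i \<le> y" for i
    using less[of i] ge[of i] that by (cases "i < x") auto
qed

text \<open>All cases of the theorem are instances with different \<open>x\<close>;
  \<open>inc\<close> and \<open>dec\<close> restate the rise and fall of the peaks as arithmetic
  conditions on \<open>r\<close>, \<open>k\<close> and \<open>i\<close>.\<close>

lemma mu_nu_unimodal:
  assumes "b \<ge> 2" "2 * y < r" "r < k - 1" "x \<le> y"
    and inc: "\<And>i. i < x \<Longrightarrow> even r \<or> 4 * i + 3 \<le> r \<and> \<not> (r = 4 * i + 3 \<and> k - r = 2)"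
    and dec: "\<And>i. x \<le> i \<Longrightarrow> i < y \<Longrightarrow> odd r \<and> (r \<le> 4 * i + 1 \<or> r = 4 * i + 3 \<and> k - r = 2)"
  shows "\<nu> b k r y = \<gamma> b k r x + 1 \<and> real (\<mu> b k r y) = V (int k) (int r) (int x)"
proof -
  let ?f = "\<lambda>i. peak (r - 2 * i) (k - r) 1 i"
  have up: "?f i < ?f (Suc i)" if "i < x" for i
    using peak_less_Suc[of i r "k - r"] inc[OF that] that assms by simp
  have down: "?f (Suc i) \<le> ?f i" if "x \<le> i" "i < y" for i
    using peak_Suc_le[of i r "k - r"] dec[OF that] that assms by simp
  have "\<mu> b k r y = ?f x" "\<nu> b k r y = \<gamma> b k r x + 1"
    using unimodal_max[of x ?f y, OF up down]
    by (intro mu_nu_eqI[OF assms(1-4)]; blast)+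
  then show ?thesis using V_eq_peak[of x r k] assms by simp
qed

theorem theorem23:
  fixes b k r y :: nat
  assumes "b \<ge> 2"
    and "2 * y < r" and "r < k - 1"
  shows "(even r \<longrightarrow>
            \<nu> b k r y = \<gamma> b k r y + 1 \<and> real (\<mu> b k r y) = V k r y) \<and>
         (k - 2 = r \<and> r mod 4 = 3 \<and> real y \<ge> (real r + 1) / 4 \<longrightarrow>
            \<nu> b k r y = \<gamma> b k r ((r - 3) div 4) + 1 \<and>
            real (\<mu> b k r y) = V k r ((r - 3) div 4)) \<and>
         (\<not> even r \<and> \<not> (k - 2 = r \<and> r mod 4 = 3 \<and> real y \<ge> (real r + 1) / 4) \<longrightarrow>
            \<nu> b k r y = \<gamma> b k r (\<delta> r y) + 1 \<and> real (\<mu> b k r y) = V k r (\<delta> r y))"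
proof (intro conjI[of "_ \<longrightarrow> _"] impI)
  assume "even r"
  \<comment> \<open>For even \<open>r\<close> the peaks rise all the way to \<open>y\<close>, and
    nothing remains to check beyond it.\<close>
  then show "\<nu> b k r y = \<gamma> b k r y + 1 \<and> real (\<mu> b k r y) = V k r y"
    by (intro mu_nu_unimodal[OF assms]) auto
next
  assume *: "k - 2 = r \<and> r mod 4 = 3 \<and> real y \<ge> (real r + 1) / 4"
  define x where "x = (r - 3) div 4"
  have "r mod 4 = 3" using * by blast
  then have r: "r = 4 * x + 3" unfolding x_def by presburger
  have "x + 1 \<le> y" using * by (simp add: r)
  \<comment> \<open>With \<open>k - r = 2\<close> the peaks at \<open>x\<close> and
    \<open>x + 1\<close> tie, and both indices are admissible; the smaller one gives the
    minimum.\<close>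
  then have "\<nu> b k r y = \<gamma> b k r x + 1 \<and> real (\<mu> b k r y) = V k r x"
    by (intro mu_nu_unimodal[OF assms]) (use * r in auto)
  then show "\<nu> b k r y = \<gamma> b k r ((r - 3) div 4) + 1 \<and>
            real (\<mu> b k r y) = V k r ((r - 3) div 4)"
    by (simp add: x_def)
next
  assume *: "\<not> even r \<and> \<not> (k - 2 = r \<and> r mod 4 = 3 \<and> real y \<ge> (real r + 1) / 4)"
  \<comment> \<open>The ceiling marks where \<open>r - 4 * i - 1\<close> ceases to be positive, that
    is, where the peaks stop rising for odd \<open>r\<close>.\<close>
  have lt: "i < nat \<lceil>(real r - 1) / 4\<rceil> \<longleftrightarrow> 4 * i + 1 < r" for i
  proof -
    have "i < nat \<lceil>(real r - 1) / 4\<rceil> \<longleftrightarrow> real i < (real r - 1) / 4"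
      by (simp add: zless_nat_eq_int_zless less_ceiling_iff)
    also have "\<dots> \<longleftrightarrow> real (4 * i + 1) < real r" by (simp add: field_simps)
    finally show ?thesis unfolding of_nat_less_iff .
  qed
  show "\<nu> b k r y = \<gamma> b k r (\<delta> r y) + 1 \<and> real (\<mu> b k r y) = V k r (\<delta> r y)"
  proof (rule mu_nu_unimodal[OF assms])
    show "\<delta> r y \<le> y" by (simp add: \<delta>_def)
  next
    fix i assume "i < \<delta> r y"
    then have i: "i < y" "4 * i + 1 < r" using lt by (simp_all add: \<delta>_def)
    moreover have "odd r" using * by blast
    ultimately have "4 * i + 3 \<le> r" by presburger
    \<comment> \<open>A tie at \<open>i\<close> would give
      \<open>(r + 1) / 4 = i + 1 \<le> y\<close> and \<open>k - 2 = r\<close>, which is the excluded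
      case.\<close>
    moreover have "\<not> (r = 4 * i + 3 \<and> k - r = 2)"
      using * i(1) assms(3) by auto
    ultimately show "even r \<or> 4 * i + 3 \<le> r \<and> \<not> (r = 4 * i + 3 \<and> k - r = 2)" by blast
  next
    fix i assume "\<delta> r y \<le> i" "i < y"
    then have "\<not> i < nat \<lceil>(real r - 1) / 4\<rceil>" by (metis \<delta>_def min_less_iff_conj not_le)
    then show "odd r \<and> (r \<le> 4 * i + 1 \<or> r = 4 * i + 3 \<and> k - r = 2)"
      using * unfolding lt by auto
  qed
qed

end
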